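(* Let $n\geq 9$ be an integer. Then for each positive integer $k$ we have $$p_{n}^{(k)}<2^{2k-1}\cdot n\cdot (k-1)!\cdot\big(\log(\max\{k,n\})\big)^{k}.$$ In particular, $$p_{n}^{(k)}< \big(4\cdot k\log k\big)^{k}$$ for $k\geq n$.
   Context: $p_n$ denotes the $n$th prime number ($p_1=2$, $p_2=3$, ...). For positive integers $n,k$, define $p_n^{(k)}$ recursively by $p_n^{(1)}:=p_n$ and $p_n^{(k)}:=p_{p_n^{(k-1)}}$ for $k\ge 2$; that is, $p_n^{(k)}$ is the $p_n^{(k-1)}$th prime. $\log$ is the natural logarithm. *)

theory Defs
  imports "HOL-Analysis.Analysis" "HOL-Computational_Algebra.Primes" "HOL-Library.Infinite_Set"
begin

text \<open>
  The library's \<^const>\<open>enumerate\<close> counts from 0, whereas here the first prime has index 1.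
  Only indices \<open>n \<ge> 1\<close> are meaningful; by truncated subtraction, index 0 also yields 2.
\<close>

definition nth_prime :: "nat \<Rightarrow> nat" where
  "nth_prime n = enumerate {p::nat. prime p} (n - 1)"

text \<open>
  \<open>iter_prime k n\<close> is $p_n^{(k)}$. The intended range is \<open>k \<ge> 1\<close>; at \<open>k = 0\<close> it is \<open>n\<close>.
\<close>

definition iter_prime :: "nat \<Rightarrow> nat \<Rightarrow> nat" where
  "iter_prime k n = (nth_prime ^^ k) n"

lemma iter_prime_1: "iter_prime 1 n = nth_prime n"
  by (simp add: iter_prime_def)

lemma iter_prime_rec: "k \<ge> 2 \<Longrightarrow> iter_prime k n = nth_prime (iter_prime (k - 1) n)"
  by (cases k) (simp_all add: iter_prime_def)

lemma nth_prime_1: "nth_prime 1 = 2"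
  unfolding nth_prime_def
  by (auto simp: enumerate_0 intro!: Least_equality prime_ge_2_nat)

lemma prime_nth_prime: "prime (nth_prime n)"
  using enumerate_in_set[OF primes_infinite] by (auto simp: nth_prime_def)

lemma nth_prime_strict_mono: "1 \<le> m \<Longrightarrow> m < n \<Longrightarrow> nth_prime m < nth_prime n"
  unfolding nth_prime_def by (intro enumerate_mono primes_infinite) auto

lemma nth_prime_surj: "prime p \<Longrightarrow> \<exists>n\<ge>1. nth_prime n = p"
  using enumerate_Ex[of "{p::nat. prime p}" p] primes_infinite
  by (metis nth_prime_def mem_Collect_eq add_diff_cancel_right' le_add2)

end

theory Submission
  imports Defs
begin

text \<open>
  Everything follows from $p_n < 2 n \log n$ for $n \ge 9$ by induction on $k$: if $B$ is the bound
  for $p_n^{(k-1)}$ and $m = \max\{k, n\}$, then $2 B \log B$ is at most the next bound as soon as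
  $B \le m^{2(k-1)}$, which reduces to $4 \log m \le m$, true for $m \ge 9$.

  For $n \ge 1000$ the inequality $p_n < 2 n \log n$ is of Chebyshev type. Any common multiple of
  $1, \dots, 2m$ is divisible by $m \binom{2m}{m}$, and the least one is at most $(2m)^{\pi(2m)}$.
  Hence $2^{2m} \le (2m)^{\pi(2m) + 1}$, which for $2m = p_n - 1$ reads
  $2^{p_n - 1} \le (p_n - 1)^n$. The remaining $n$ are covered by eleven blocks $a \le n \le b$ with
  $p_b < 2 a \log a$.
\<close>

section \<open>A Chebyshev bound\<close>

text \<open>
  The numbers $L(n, k) = k \binom{n}{k}$ are the reciprocals of the entries of Leibniz's harmonic
  triangle: $1 / L(n, k + 1) = 1 / L(n - 1, k) - 1 / L(n, k)$. So $D / L(n, k + 1)$ is an integer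
  if $D / L(n - 1, k)$ and $D / L(n, k)$ are.
\<close>

lemma mult_binomial_dvd:
  fixes D n k :: nat
  assumes "\<And>j. 1 \<le> j \<Longrightarrow> j \<le> n \<Longrightarrow> j dvd D" "1 \<le> k" "k \<le> n"
  shows "k * (n choose k) dvd D"
  using assms(2,3,1)
proof (induction k arbitrary: n rule: nat_induct_at_least)
  case base
  then show ?case by simp
next
  case (Suc k)
  then obtain m where n: "n = Suc m" "k \<le> m"
    by (cases n) auto
  define a b c where "a = int (k * (m choose k))" and "b = int (k * (n choose k))"
    and "c = int (Suc k * (n choose Suc k))"
  have pos: "a > 0" "b > 0" "c > 0"
    using Suc n by (auto simp: a_def b_def c_def simp del: binomial_Suc_Suc mult_Suc)
  have "k * (m choose k) dvd D" "k * (n choose k) dvd D"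
    using Suc n by auto
  then obtain u v where u: "int D = a * u" and v: "int D = b * v"
    unfolding a_def b_def by (metis int_dvd_int_iff dvdE)
  have c: "c = int n * int (m choose k)"
    unfolding c_def n(1) Suc_times_binomial by (simp add: algebra_simps)
  have "(n choose k) * (n - k) = n * (m choose k)"
    using binomial_absorb_comp[of n k] n by (simp add: mult.commute)
  hence "int (n choose k) * (int n - int k) = int n * int (m choose k)"
    using n by (metis Suc_leD of_nat_diff of_nat_mult le_SucI)
  hence nk: "int n * int (n choose k) - int n * int (m choose k) = int k * int (n choose k)"
    by (simp add: algebra_simps)
  \<comment> \<open>Aims at \<open>c * (b - a) = a * b\<close>, the triangle identity 1/c = 1/a -
    1/b with denominators cleared.\<close>
  have "c * (b - a) = int k * int (m choose k) * (int n * int (n choose k) - int n * int (m choose k))"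
    unfolding c a_def b_def by (simp add: algebra_simps)
  hence "c * (b - a) = a * b"
    unfolding nk a_def b_def by simp
  have "(b - a) * int D = b * (a * u) - a * (b * v)"
    unfolding u[symmetric] v[symmetric] by (simp add: algebra_simps)
  also have "\<dots> = a * b * (u - v)" by (simp add: algebra_simps)
  also have "a * b = c * (b - a)" using \<open>c * (b - a) = a * b\<close> by simp
  finally have "(b - a) * int D = (b - a) * (c * (u - v))" by (simp add: mult_ac)
  moreover have "b - a \<noteq> 0"
    using \<open>c * (b - a) = a * b\<close> pos by auto
  ultimately have "c dvd int D"
    by simp
  thus ?case unfolding c_def int_dvd_int_iff .
qed

text \<open>The witness is lcm(1, ..., n), the product over the primes p up to n of the largest
  power of p not exceeding n; each such factor is at most n. A power of p dividing some j in 1..n is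
  itself at most n, so its exponent is at most \<open>e p\<close>.\<close>

lemma common_multiple_le_power_primes:
  fixes n :: nat
  assumes "n \<ge> 1"
  obtains D where "\<And>j. 1 \<le> j \<Longrightarrow> j \<le> n \<Longrightarrow> j dvd D" "D > 0" "D \<le> n ^ card {p. prime p \<and> p \<le> n}"
proof -
  define P where "P = {p. prime p \<and> p \<le> n}"
  have fin: "finite P" by (auto simp: P_def)
  define e where "e p = Max {i. p ^ i \<le> n}" for p
  have e: "p ^ e p \<le> n" "\<And>i. p ^ i \<le> n \<Longrightarrow> i \<le> e p" if "p \<in> P" for p
  proof -
    have "p \<ge> 2" using that prime_ge_2_nat by (auto simp: P_def)
    \<comment> \<open>Since i < p^i, the exponents are bounded by n; finiteness makes
      \<open>Max\<close> in \<open>e\<close> meaningful.\<close>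
    hence "{i. p ^ i \<le> n} \<subseteq> {..n}"
      using power_gt_expt[of p] by (fastforce dest: less_le_trans)
    hence fin: "finite {i. p ^ i \<le> n}" by (rule finite_subset) auto
    have "p ^ 0 \<le> n" using assms by simp
    hence "e p \<in> {i. p ^ i \<le> n}" unfolding e_def by (intro Max_in[OF fin]) blast
    thus "p ^ e p \<le> n" by simp
    show "\<And>i. p ^ i \<le> n \<Longrightarrow> i \<le> e p" unfolding e_def using fin by (intro Max_ge) auto
  qed
  define D where "D = (\<Prod>p\<in>P. p ^ e p)"
  show ?thesis
  proof
    show "D > 0" unfolding D_def by (intro prod_pos) (auto simp: P_def prime_gt_0_nat)
    have "D \<le> (\<Prod>p\<in>P. n)" unfolding D_def by (intro prod_mono) (use e in auto)
    thus "D \<le> n ^ card {p. prime p \<and> p \<le> n}" by (simp add: P_def)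
    fix j assume j: "1 \<le> j" "j \<le> n"
    show "j dvd D"
    proof (rule multiplicity_le_imp_dvd)
      fix p :: nat assume p: "prime p"
      have "p ^ multiplicity p j dvd j" by (rule multiplicity_dvd)
      hence le: "p ^ multiplicity p j \<le> n" using j dvd_imp_le[of _ j] by fastforce
      have "multiplicity p D = (if p \<in> P then e p else 0)"
        unfolding D_def by (intro multiplicity_prod_prime_powers fin p) (auto simp: P_def)
      moreover have "p \<notin> P \<Longrightarrow> multiplicity p j = 0"
        using p j by (intro not_dvd_imp_multiplicity_0) (auto simp: P_def dest!: dvd_imp_le)
      ultimately show "multiplicity p j \<le> multiplicity p D" using e(2) le by auto
    qed (use j in auto)
  qed
qed

lemma two_power_le_power_card_primes:
  fixes m :: nat
  assumes "m \<ge> 1"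
  shows "2 ^ (2 * m) \<le> (2 * m) ^ (card {p. prime p \<and> p \<le> 2 * m} + 1)"
proof -
  obtain D where D: "\<And>j. 1 \<le> j \<Longrightarrow> j \<le> 2 * m \<Longrightarrow> j dvd D" "D > 0"
      "D \<le> (2 * m) ^ card {p. prime p \<and> p \<le> 2 * m}"
    using common_multiple_le_power_primes[of "2 * m"] assms by auto
  have "m * (2 * m choose m) dvd D" using D(1) assms by (intro mult_binomial_dvd) auto
  hence le: "m * (2 * m choose m) \<le> D" using D(2) by (rule dvd_imp_le)
  \<comment> \<open>Starts from 4^m / (2m) \<le> binom(2m, m). The factor m is absorbed by the
    divisor of D; the remaining 2 is enlarged to 2m, which accounts for the + 1 in the
    exponent.\<close>
  have "real (4 ^ m) \<le> real (2 * m * (2 * m choose m))"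
    using central_binomial_lower_bound[of m] assms by (simp add: field_simps)
  hence "4 ^ m \<le> 2 * m * (2 * m choose m)" by (simp only: of_nat_le_iff)
  also have "\<dots> \<le> 2 * D" using le by simp
  also have "\<dots> \<le> 2 * m * D" using assms by simp
  also have "\<dots> \<le> 2 * m * (2 * m) ^ card {p. prime p \<and> p \<le> 2 * m}" using D(3) by simp
  finally show ?thesis by (simp add: power_mult)
qed

section \<open>Large indices\<close>

lemma primes_less_nth_prime:
  assumes "n \<ge> 1"
  shows "{p. prime p \<and> p < nth_prime n} = nth_prime ` {1..<n}"
proof (intro equalityI subsetI)
  fix p assume "p \<in> {p. prime p \<and> p < nth_prime n}"
  then obtain m where "m \<ge> 1" "nth_prime m = p" "p < nth_prime n"
    using nth_prime_surj by auto
  moreover have "m < n"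
    using nth_prime_strict_mono[of n m] calculation assms by (cases m n rule: linorder_cases) auto
  ultimately show "p \<in> nth_prime ` {1..<n}" by auto
qed (auto simp: prime_nth_prime nth_prime_strict_mono)

lemma inj_on_nth_prime: "inj_on nth_prime {1..}"
  by (rule linorder_inj_onI') (use nth_prime_strict_mono in fastforce)

lemma nth_prime_mono: "1 \<le> m \<Longrightarrow> m \<le> n \<Longrightarrow> nth_prime m \<le> nth_prime n"
  using nth_prime_strict_mono[of m n] by (cases "m = n") auto

lemma card_primes_less_nth_prime:
  assumes "n \<ge> 1"
  shows "card {p. prime p \<and> p < nth_prime n} = n - 1"
  unfolding primes_less_nth_prime[OF assms]
  by (subst card_image) (auto intro: inj_on_subset[OF inj_on_nth_prime])

lemma less_nth_prime: "n \<ge> 1 \<Longrightarrow> n < nth_prime n"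
proof (induction n rule: dec_induct)
  case (step n)
  then show ?case using nth_prime_strict_mono[of n "Suc n"] by auto
qed (use nth_prime_1 in auto)

lemma two_power_pred_nth_prime_le:
  assumes "n \<ge> 2"
  shows "2 ^ (nth_prime n - 1) \<le> (nth_prime n - 1) ^ n"
proof -
  have gt: "nth_prime n > 2" using less_nth_prime[of n] assms by auto
  hence "odd (nth_prime n)" using prime_nth_prime prime_odd_nat by blast
  then obtain m where m: "nth_prime n = 2 * m + 1" by (elim oddE)
  \<comment> \<open>Exactly n - 1 primes lie below the nth, so the exponent of the Chebyshev bound
    becomes n.\<close>
  have "{p. prime p \<and> p \<le> 2 * m} = {p. prime p \<and> p < nth_prime n}" using m by auto
  hence "card {p. prime p \<and> p \<le> 2 * m} + 1 = n"
    using card_primes_less_nth_prime[of n] assms by simp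
  thus ?thesis using two_power_le_power_card_primes[of m] m gt by simp
qed

section \<open>Rational bounds for e and the logarithm\<close>

lemma exp_1_bounds: "8 / 3 < exp (1::real)" "exp (1::real) < 272 / 100"
proof -
  have "\<bar>exp 1 - 5837465777 / 2147483648\<bar> \<le> (1 / 100 :: real)"
    by (rule order_trans[OF e_approx_32]) (simp add: field_simps)
  thus "8 / 3 < exp (1::real)" by linarith
qed (fact e_less_272)

text \<open>As e < 2.72, a comparison of rational powers certifies r / s < ln x.\<close>

lemma less_ln_of_power:
  fixes x :: real and r s :: nat
  assumes "r > 0" "x > 0" "(272 / 100) ^ r \<le> x ^ s"
  shows "real r < real s * ln x"
proof -
  have "exp (real r) = exp 1 ^ r" by (simp flip: exp_of_nat_mult)
  also have "\<dots> < (272 / 100) ^ r"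
    using exp_1_bounds assms(1) by (intro power_strict_mono) auto
  also have "\<dots> \<le> x ^ s" by fact
  also have "\<dots> = exp (real s * ln x)" using assms(2) by (simp add: exp_of_nat_mult)
  finally show ?thesis by simp
qed

text \<open>At 9 it follows from 9^4 \<le> (8/3)^9 < e^9; beyond, from the tangent of ln at 9, since
  4/9 < 1. The inequality fails at 8.\<close>

lemma four_ln_le:
  fixes x :: real
  assumes "x \<ge> 9"
  shows "4 * ln x \<le> x"
proof -
  have "(9::real) ^ 4 \<le> (8 / 3) ^ 9" by (simp add: power_divide)
  also have "\<dots> \<le> exp 1 ^ 9" using exp_1_bounds by (intro power_mono) auto
  finally have "ln ((9::real) ^ 4) \<le> ln (exp 9)"
    by (subst ln_le_cancel_iff) (auto simp flip: exp_of_nat_mult)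
  hence "4 * ln (9::real) \<le> 9" by (subst (asm) ln_realpow) auto
  moreover have "ln (x / 9) \<le> x / 9 - 1" using assms by (intro ln_le_minus_one) auto
  ultimately show ?thesis using assms by (simp add: ln_div field_simps)
qed

text \<open>With y = p_n - 1, the Chebyshev bound reads y ln 2 \<le> n ln y. If y \<ge> z - 1 for z
  = 2 n ln n, replacing ln y by its tangent at z moves the inequality down to z - 1, where it fails
  because 2 ln 2 > 1.\<close>

lemma nth_prime_less_large:
  assumes "n \<ge> 1000"
  shows "real (nth_prime n) < 2 * real n * ln (real n)"
proof (rule ccontr)
  define u where "u = ln (real n)"
  define z where "z = 2 * real n * u"
  define y where "y = real (nth_prime n - 1)"
  assume "\<not> ?thesis"
  hence yz: "y \<ge> z - 1" by (auto simp: y_def z_def u_def)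
  \<comment> \<open>The constants 6.9 and 9/13 approximate ln 1000 (about 6.908) and ln 2 (about
    0.6931) from below.\<close>
  have "real 69 < real 10 * ln 1000" by (intro less_ln_of_power) (auto simp: power_divide)
  moreover have "ln 1000 \<le> u" using assms by (simp add: u_def)
  ultimately have u: "u > 69 / 10" by simp
  have "real 9 < real 13 * ln 2" by (intro less_ln_of_power) (auto simp: power_divide)
  hence ln2: "ln (2::real) > 9 / 13" by simp
  have z: "z > 1000" unfolding z_def using assms u mult_mono[of 2000 "2 * real n" 1 u] by simp
  have y: "y > 0" using yz z by simp
  have "real (2 ^ (nth_prime n - 1)) \<le> real ((nth_prime n - 1) ^ n)"
    by (intro of_nat_mono two_power_pred_nth_prime_le) (use assms in simp)
  hence "(2::real) ^ (nth_prime n - 1) \<le> y ^ n"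
    by (simp only: y_def of_nat_power of_nat_numeral)
  hence "ln ((2::real) ^ (nth_prime n - 1)) \<le> ln (y ^ n)"
    using y by (subst ln_le_cancel_iff) auto
  hence "y * ln 2 \<le> real n * ln y" using y by (simp add: ln_realpow y_def)
  also have "ln (y / z) \<le> y / z - 1" using y z by (intro ln_le_minus_one) auto
  hence "ln y \<le> ln z + (y - z) / z" using y z by (simp add: ln_div diff_divide_distrib)
  hence "real n * ln y \<le> real n * (ln z + (y - z) / z)" by (intro mult_left_mono) auto
  also have "\<dots> = real n * ln z + (y - z) / (2 * u)"
    using u assms by (simp add: z_def field_simps)
  finally have 1: "y * ln 2 \<le> real n * ln z + (y - z) / (2 * u)" .
  \<comment> \<open>The right side of \<open>1\<close> has slope 1/(2u) in y, the left side slope ln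
    2. As the latter is larger, lowering y to z - 1 preserves the inequality.\<close>
  have "1 / (2 * u) \<le> 1 / 2" using u by (simp add: divide_le_eq)
  also have "1 / 2 \<le> ln (2::real)" using ln2 by linarith
  finally have "1 / (2 * u) \<le> ln 2" .
  hence "(y - z + 1) * (1 / (2 * u)) \<le> (y - z + 1) * ln 2"
    using yz by (intro mult_left_mono) auto
  moreover have "(y - z + 1) * (1 / (2 * u)) = (y - z) / (2 * u) + 1 / (2 * u)"
    by (simp add: add_divide_distrib)
  moreover have "(y - z + 1) * ln 2 = y * ln 2 - z * ln 2 + ln 2"
    by (simp add: algebra_simps)
  moreover have "1 / (2 * u) > 0" using u by simp
  ultimately have 2: "z * ln 2 - ln 2 \<le> real n * ln z"
    using 1 by linarith
  \<comment> \<open>Tangent of the logarithm at 16, the power of 2 closest to \<open>2 * ln 1000\<close>.\<close>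
  have "ln (2 * u / 16) \<le> 2 * u / 16 - 1" using u by (intro ln_le_minus_one) auto
  moreover have "ln (2 * u / 16) = ln (2 * u) - ln (2 ^ 4)" using u by (subst ln_div) auto
  ultimately have "ln (2 * u) \<le> u / 8 - 1 + ln (2 ^ 4)" by linarith
  also have "ln ((2::real) ^ 4) = 4 * ln 2" by (subst ln_realpow) auto
  finally have lnu: "ln (2 * u) \<le> u / 8 - 1 + 4 * ln 2" .
  have "ln z = u + ln (2 * u)" using u assms by (simp add: z_def u_def ln_mult)
  hence "z * ln 2 - ln 2 \<le> real n * (u + u / 8 - 1 + 4 * ln 2)"
    using 2 lnu mult_left_mono[of "ln z" "u + u / 8 - 1 + 4 * ln 2" "real n"] by linarith
  hence "real n * (2 * u * ln 2 - u - u / 8 + 1 - 4 * ln 2) \<le> ln 2"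
    by (simp add: z_def algebra_simps)
  moreover have "2 * u * ln 2 - u - u / 8 + 1 - 4 * ln 2 \<ge> 1 / 1000"
  proof -
    \<comment> \<open>With the terms in ln 2 collected, the expression is at least 27u/104 - 23/13,
      which exceeds 1/1000 for u > 6.9. Multiplied by n \<ge> 1000 it reaches 1 > ln 2.\<close>
    have "(2 * u - 4) * ln 2 \<ge> (2 * u - 4) * (9 / 13)"
      using u ln2 by (intro mult_left_mono) auto
    moreover have "(2 * u - 4) * ln 2 = 2 * (u * ln 2) - 4 * ln 2" by (simp add: algebra_simps)
    moreover have "2 * u * ln 2 = 2 * (u * ln 2)" by simp
    moreover have "(2 * u - 4) * (9 / 13) = 18 / 13 * u - 36 / 13" by (simp add: field_simps)
    ultimately show ?thesis using u by linarith
  qed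
  hence "real n * (2 * u * ln 2 - u - u / 8 + 1 - 4 * ln 2) \<ge> 1000 * (1 / 1000)"
    using assms by (intro mult_mono) auto
  ultimately show False using ln_2_less_1 by linarith
qed

section \<open>Small indices\<close>

text \<open>The fraction \<open>r / s\<close> is a lower bound for \<open>ln a\<close>, certified by $2.72^r \le a^s$.\<close>

lemma nth_prime_less_of_block:
  fixes a b n X r s :: nat
  assumes "nth_prime b \<le> X" "X * s \<le> 2 * a * r" "(272 / 100) ^ r \<le> real a ^ s"
    "r > 0" "s > 0" "a > 0" "a \<le> n" "n \<le> b"
  shows "real (nth_prime n) < 2 * real n * ln (real n)"
proof -
  have "real (nth_prime n) * real s \<le> real X * real s"
    using nth_prime_mono[of n b] assms by (intro mult_right_mono) auto
  also have "\<dots> \<le> 2 * real a * real r"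
    using assms(2) by (metis of_nat_le_iff of_nat_mult of_nat_numeral)
  also have "\<dots> < 2 * real a * (real s * ln (real a))"
    using less_ln_of_power[of r "real a" s] assms by simp
  also have "\<dots> \<le> 2 * real n * (real s * ln (real n))"
    using assms by (intro mult_mono) auto
  finally show ?thesis using assms by simp
qed

section \<open>A sieve for primes up to 10000\<close>

definition small_primes :: "int list" where
  "small_primes = [2, 3, 5, 7, 11, 13, 17, 19, 23, 29, 31, 37, 41, 43, 47,
     53, 59, 61, 67, 71, 73, 79, 83, 89, 97]"

text \<open>
  The sieve works on integers because the default code equations for them are binary,
  whereas those for natural numbers are unary.
\<close>

definition passes_sieve :: "int \<Rightarrow> bool" where
  "passes_sieve q \<longleftrightarrow> list_all (\<lambda>d. q mod d \<noteq> 0 \<or> q = d) small_primes"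

lemma small_primes_divisor:
  assumes "2 \<le> d" "d \<le> 100"
  obtains e where "e \<in> set small_primes" "e dvd d"
proof -
  have "\<forall>d\<in>set [2..100]. \<exists>e\<in>set small_primes. d mod e = 0"
    by code_simp
  hence "\<forall>d\<in>{2..100}. \<exists>e\<in>set small_primes. e dvd d"
    unfolding set_upto dvd_eq_mod_eq_0 .
  moreover have "d \<in> {2..100}" using assms by simp
  ultimately show ?thesis using that by blast
qed

text \<open>A composite q \<le> 100^2 has a proper factor between 2 and 100, hence a divisor in
  \<open>small_primes\<close>.\<close>

lemma prime_if_passes_sieve:
  fixes q :: nat
  assumes "passes_sieve (int q)" "2 \<le> q" "q \<le> 10000"
  shows "prime q"
proof (rule ccontr)
  assume "\<not> prime q"
  then obtain d where "d dvd q" "d \<noteq> 1" "d \<noteq> q" using assms by (auto simp: prime_nat_iff)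
  then obtain e where de: "q = d * e" by auto
  have "d \<noteq> 0" "e \<noteq> 0" "e \<noteq> 1" using de assms(2) \<open>d \<noteq> q\<close> by (intro notI; simp)+
  hence d: "d \<ge> 2" "e \<ge> 2" using \<open>d \<noteq> 1\<close> by linarith+
  have "min d e \<le> 100"
  proof (rule ccontr)
    assume "\<not> ?thesis"
    hence "101 \<le> d" "101 \<le> e" by linarith+
    hence "101 * 101 \<le> d * e" by (rule mult_le_mono)
    thus False using de assms(3) by linarith
  qed
  define f where "f = min d e"
  have f: "2 \<le> f" "f \<le> 100" "f dvd q" "f < q"
    using d de \<open>min d e \<le> 100\<close> by (auto simp: f_def min_def split: if_splits)
  then obtain g where g: "g \<in> set small_primes" "g dvd int f"
    using small_primes_divisor[of "int f"] by (metis of_nat_le_iff of_nat_numeral)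
  hence "g \<le> int f" "g dvd int q"
    using f by (auto intro: zdvd_imp_le dvd_trans)
  \<comment> \<open>Here g \<le> f < q, so the exception \<open>q = d\<close>, which lets the small
    primes themselves pass, does not apply.\<close>
  thus False using assms(1) g(1) f by (auto simp: passes_sieve_def list_all_iff dvd_eq_mod_eq_0)
qed

text \<open>Pigeonhole: the k sieved numbers in (a, b] are primes of index above n. If p_m > b,
  these indices would lie strictly between n and n + k, which leaves only k - 1 places.\<close>

lemma nth_prime_le_sieve:
  fixes n m a b :: nat
  assumes "nth_prime n \<le> a" "length (filter passes_sieve [int a + 1..int b]) = k"
    "m = n + k" "n \<ge> 1" "a \<le> b" "b \<le> 10000"
  shows "nth_prime m \<le> b"
proof (rule ccontr)
  assume less: "\<not> nth_prime m \<le> b"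
  define S where "S = set (filter passes_sieve [int a + 1..int b])"
  have "nat ` S \<subseteq> nth_prime ` {n<..<m}"
  proof
    fix p assume "p \<in> nat ` S"
    hence p: "passes_sieve (int p)" "a < p" "p \<le> b" by (auto simp: S_def)
    have "a \<ge> 2" using prime_ge_2_nat[OF prime_nth_prime[of n]] assms(1) by linarith
    hence "prime p" using p assms by (intro prime_if_passes_sieve) auto
    then obtain i where i: "i \<ge> 1" "nth_prime i = p" using nth_prime_surj by auto
    have "i > n" using nth_prime_mono[of i n] i p assms(1) by (cases "i > n") auto
    moreover have "i < m" using nth_prime_mono[of m i] i p less assms by (cases "i < m") auto
    ultimately show "p \<in> nth_prime ` {n<..<m}" using i by auto
  qed
  hence "card (nat ` S) \<le> card {n<..<m}"
    by (rule surj_card_le[rotated]) auto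
  moreover have "card (nat ` S) = card S"
    by (intro card_image inj_onI) (auto simp: S_def)
  moreover have "card S = k"
    unfolding S_def using assms(2) by (subst distinct_card) auto
  \<comment> \<open>The open interval has k - 1 elements in truncated subtraction, so k = 0 remains;
    then m = n and the bound is inherited from a.\<close>
  ultimately have "k = 0" using assms by simp
  thus False using less assms by simp
qed

text \<open>First link of a chain from p_1 = 2 to p_1000, each link sieving one further interval.
  The stops are the right ends of the blocks in \<open>nth_prime_less\<close> and some intermediate
  indices that keep the intervals short.\<close>

lemma nth_prime_12: "nth_prime 12 \<le> 37"
proof (rule nth_prime_le_sieve[OF eq_refl[OF nth_prime_1]])
  show "length (filter passes_sieve [int 2 + 1..int 37]) = 11"
    unfolding of_nat_numeral by code_simp
qed simp_all

lemma nth_prime_18: "nth_prime 18 \<le> 61"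
proof (rule nth_prime_le_sieve[OF nth_prime_12])
  show "length (filter passes_sieve [int 37 + 1..int 61]) = 6"
    unfolding of_nat_numeral by code_simp
qed simp_all

lemma nth_prime_29: "nth_prime 29 \<le> 109"
proof (rule nth_prime_le_sieve[OF nth_prime_18])
  show "length (filter passes_sieve [int 61 + 1..int 109]) = 11"
    unfolding of_nat_numeral by code_simp
qed simp_all

lemma nth_prime_46: "nth_prime 46 \<le> 199"
proof (rule nth_prime_le_sieve[OF nth_prime_29])
  show "length (filter passes_sieve [int 109 + 1..int 199]) = 17"
    unfolding of_nat_numeral by code_simp
qed simp_all

lemma nth_prime_72: "nth_prime 72 \<le> 359"
proof (rule nth_prime_le_sieve[OF nth_prime_46])
  show "length (filter passes_sieve [int 199 + 1..int 359]) = 26"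
    unfolding of_nat_numeral by code_simp
qed simp_all

lemma nth_prime_114: "nth_prime 114 \<le> 619"
proof (rule nth_prime_le_sieve[OF nth_prime_72])
  show "length (filter passes_sieve [int 359 + 1..int 619]) = 42"
    unfolding of_nat_numeral by code_simp
qed simp_all

lemma nth_prime_181: "nth_prime 181 \<le> 1087"
proof (rule nth_prime_le_sieve[OF nth_prime_114])
  show "length (filter passes_sieve [int 619 + 1..int 1087]) = 67"
    unfolding of_nat_numeral by code_simp
qed simp_all

lemma nth_prime_290: "nth_prime 290 \<le> 1889"
proof (rule nth_prime_le_sieve[OF nth_prime_181])
  show "length (filter passes_sieve [int 1087 + 1..int 1889]) = 109"
    unfolding of_nat_numeral by code_simp
qed simp_all

lemma nth_prime_376: "nth_prime 376 \<le> 2579"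
proof (rule nth_prime_le_sieve[OF nth_prime_290])
  show "length (filter passes_sieve [int 1889 + 1..int 2579]) = 86"
    unfolding of_nat_numeral by code_simp
qed simp_all

lemma nth_prime_462: "nth_prime 462 \<le> 3271"
proof (rule nth_prime_le_sieve[OF nth_prime_376])
  show "length (filter passes_sieve [int 2579 + 1..int 3271]) = 86"
    unfolding of_nat_numeral by code_simp
qed simp_all

lemma nth_prime_540: "nth_prime 540 \<le> 3907"
proof (rule nth_prime_le_sieve[OF nth_prime_462])
  show "length (filter passes_sieve [int 3271 + 1..int 3907]) = 78"
    unfolding of_nat_numeral by code_simp
qed simp_all

lemma nth_prime_620: "nth_prime 620 \<le> 4583"
proof (rule nth_prime_le_sieve[OF nth_prime_540])
  show "length (filter passes_sieve [int 3907 + 1..int 4583]) = 80"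
    unfolding of_nat_numeral by code_simp
qed simp_all

lemma nth_prime_684: "nth_prime 684 \<le> 5113"
proof (rule nth_prime_le_sieve[OF nth_prime_620])
  show "length (filter passes_sieve [int 4583 + 1..int 5113]) = 64"
    unfolding of_nat_numeral by code_simp
qed simp_all

lemma nth_prime_747: "nth_prime 747 \<le> 5669"
proof (rule nth_prime_le_sieve[OF nth_prime_684])
  show "length (filter passes_sieve [int 5113 + 1..int 5669]) = 63"
    unfolding of_nat_numeral by code_simp
qed simp_all

lemma nth_prime_810: "nth_prime 810 \<le> 6221"
proof (rule nth_prime_le_sieve[OF nth_prime_747])
  show "length (filter passes_sieve [int 5669 + 1..int 6221]) = 63"
    unfolding of_nat_numeral by code_simp
qed simp_all

lemma nth_prime_870: "nth_prime 870 \<le> 6761"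
proof (rule nth_prime_le_sieve[OF nth_prime_810])
  show "length (filter passes_sieve [int 6221 + 1..int 6761]) = 60"
    unfolding of_nat_numeral by code_simp
qed simp_all

lemma nth_prime_930: "nth_prime 930 \<le> 7297"
proof (rule nth_prime_le_sieve[OF nth_prime_870])
  show "length (filter passes_sieve [int 6761 + 1..int 7297]) = 60"
    unfolding of_nat_numeral by code_simp
qed simp_all

lemma nth_prime_1000: "nth_prime 1000 \<le> 7919"
proof (rule nth_prime_le_sieve[OF nth_prime_930])
  show "length (filter passes_sieve [int 7297 + 1..int 7919]) = 70"
    unfolding of_nat_numeral by code_simp
qed simp_all

lemma nth_prime_less:
  assumes "n \<ge> 9"
  shows "real (nth_prime n) < 2 * real n * ln (real n)"
proof -
  consider "9 \<le> n" "n \<le> 12" | "13 \<le> n" "n \<le> 18" | "19 \<le> n" "n \<le> 29"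
    | "30 \<le> n" "n \<le> 46" | "47 \<le> n" "n \<le> 72" | "73 \<le> n" "n \<le> 114"
    | "115 \<le> n" "n \<le> 181" | "182 \<le> n" "n \<le> 290" | "291 \<le> n" "n \<le> 462"
    | "463 \<le> n" "n \<le> 747" | "748 \<le> n" "n \<le> 1000" | "1000 \<le> n"
    using assms by linarith
  then show ?thesis
  proof cases
    case 1
    then show ?thesis
      \<comment> \<open>Here 13/6 < ln 9 and 37 * 6 \<le> 2 * 9 * 13; the other blocks follow this
        pattern.\<close>
      by (intro nth_prime_less_of_block[OF nth_prime_12, where a = 9 and r = 13 and s = 6])
        (simp_all add: power_divide)
  next
    case 2
    then show ?thesis
      by (intro nth_prime_less_of_block[OF nth_prime_18, where a = 13 and r = 5 and s = 2])
        (simp_all add: power_divide)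
  next
    case 3
    then show ?thesis
      by (intro nth_prime_less_of_block[OF nth_prime_29, where a = 19 and r = 23 and s = 8])
        (simp_all add: power_divide)
  next
    case 4
    then show ?thesis
      by (intro nth_prime_less_of_block[OF nth_prime_46, where a = 30 and r = 10 and s = 3])
        (simp_all add: power_divide)
  next
    case 5
    then show ?thesis
      by (intro nth_prime_less_of_block[OF nth_prime_72, where a = 47 and r = 23 and s = 6])
        (simp_all add: power_divide)
  next
    case 6
    then show ?thesis
      by (intro nth_prime_less_of_block[OF nth_prime_114, where a = 73 and r = 17 and s = 4])
        (simp_all add: power_divide)
  next
    case 7
    then show ?thesis
      by (intro nth_prime_less_of_block[OF nth_prime_181, where a = 115 and r = 52 and s = 11])
        (simp_all add: power_divide)
  next
    case 8
    then show ?thesis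
      by (intro nth_prime_less_of_block[OF nth_prime_290, where a = 182 and r = 26 and s = 5])
        (simp_all add: power_divide)
  next
    case 9
    then show ?thesis
      by (intro nth_prime_less_of_block[OF nth_prime_462, where a = 291 and r = 17 and s = 3])
        (simp_all add: power_divide)
  next
    case 10
    then show ?thesis
      by (intro nth_prime_less_of_block[OF nth_prime_747, where a = 463 and r = 49 and s = 8])
        (simp_all add: power_divide)
  next
    case 11
    then show ?thesis
      by (intro nth_prime_less_of_block[OF nth_prime_1000, where a = 748 and r = 6 and s = 1])
        (simp_all add: power_divide)
  next
    case 12
    then show ?thesis by (rule nth_prime_less_large)
  qed
qed

section \<open>Iterated primes\<close>

lemma fact_le_power_of_le:
  assumes "i \<le> m"
  shows "fact i \<le> real m ^ i"
proof -
  have "fact i \<le> real (i ^ i)" by (rule fact_le_power)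
  also have "\<dots> \<le> real m ^ i" using assms by (simp add: power_mono)
  finally show ?thesis .
qed

text \<open>Both n (j-1)! and (4 ln m)^j are at most m^j. The purpose is ln B \<le> 2 j ln m for the
  bound B in the induction.\<close>

lemma iter_prime_bound_le_power:
  fixes m n j :: nat
  assumes "m \<ge> 9" "n \<le> m" "1 \<le> j" "j \<le> m"
  shows "2 ^ (2 * j - 1) * real n * fact (j - 1) * ln (real m) ^ j \<le> real m ^ (2 * j)"
proof -
  have m: "real m \<ge> 9" using assms by simp
  have j: "j = Suc (j - 1)" using assms by simp
  have "fact (j - 1) \<le> real m ^ (j - 1)"
    using fact_le_power_of_le[of "j - 1" m] assms by simp
  moreover have "real n \<le> real m" using assms by simp
  ultimately have "real n * fact (j - 1) \<le> real m * real m ^ (j - 1)"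
    by (intro mult_mono) auto
  also have "\<dots> = real m ^ j" using j by (metis power_Suc)
  finally have 1: "real n * fact (j - 1) \<le> real m ^ j" .
  have "2 ^ (2 * j - 1) * ln (real m) ^ j \<le> 2 ^ (2 * j) * ln (real m) ^ j"
    using m by (intro mult_right_mono power_increasing) auto
  also have "\<dots> = (4 * ln (real m)) ^ j" by (simp add: power_mult power_mult_distrib)
  also have "\<dots> \<le> real m ^ j" using m four_ln_le[OF m] by (intro power_mono) auto
  finally have 2: "2 ^ (2 * j - 1) * ln (real m) ^ j \<le> real m ^ j" .
  have "2 ^ (2 * j - 1) * real n * fact (j - 1) * ln (real m) ^ j
      = (2 ^ (2 * j - 1) * ln (real m) ^ j) * (real n * fact (j - 1))"
    by (simp add: mult_ac)
  also have "\<dots> \<le> real m ^ j * real m ^ j" using 1 2 m by (intro mult_mono) auto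
  finally show ?thesis by (simp add: mult_2 power_add)
qed

text \<open>Keeps every iterate at least 9, so that \<open>nth_prime_less\<close> applies to
  it.\<close>

lemma iter_prime_ge: "n \<ge> 1 \<Longrightarrow> n \<le> iter_prime k n"
proof (induction k)
  case (Suc k)
  then show ?case using less_nth_prime[of "iter_prime k n"] by (simp add: iter_prime_def)
qed (simp add: iter_prime_def)

lemma iter_prime_less:
  fixes n k :: nat
  assumes "n \<ge> 9" "k \<ge> 1"
  shows "real (iter_prime k n)
           < 2 ^ (2 * k - 1) * real n * fact (k - 1) * ln (real (max k n)) ^ k"
  using assms(2)
proof (induction k rule: nat_induct_at_least)
  case base
  then show ?case using nth_prime_less[OF assms(1)] assms(1) by (simp add: iter_prime_1[simplified])
next
  case (Suc j)
  define m where "m = max (Suc j) n"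
  define P where "P = iter_prime j n"
  define B where "B = 2 ^ (2 * j - 1) * real n * fact (j - 1) * ln (real m) ^ j"
  have m: "m \<ge> 9" "n \<le> m" "j \<le> m" using assms by (auto simp: m_def)
  have P: "P \<ge> 9" using iter_prime_ge[of n j] assms by (simp add: P_def)
  note Suc.IH
  \<comment> \<open>The logarithm is enlarged to that of m = max(j + 1, n), so that old and new
    bound share it.\<close>
  also have "2 ^ (2 * j - 1) * real n * fact (j - 1) * ln (real (max j n)) ^ j \<le> B"
    unfolding B_def using assms by (intro mult_left_mono power_mono) (auto simp: m_def)
  finally have PB: "real P < B" by (simp add: P_def)
  have "ln B \<le> ln (real m ^ (2 * j))"
    using iter_prime_bound_le_power[OF m(1,2) Suc.hyps m(3)] PB
    unfolding B_def by (subst ln_le_cancel_iff) (use m in auto)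
  also have "\<dots> = 2 * real j * ln (real m)" using m by (subst ln_realpow) auto
  finally have lnB: "ln B \<le> 2 * real j * ln (real m)" .
  have "real (iter_prime (Suc j) n) = real (nth_prime P)" by (simp add: P_def iter_prime_def)
  also have "\<dots> < 2 * real P * ln (real P)" by (rule nth_prime_less[OF P])
  also have "\<dots> \<le> 2 * B * ln B" using PB P by (intro mult_mono) auto
  also have "\<dots> \<le> 2 * B * (2 * real j * ln (real m))"
    using lnB PB by (intro mult_left_mono) auto
  \<comment> \<open>The new factor 4 j ln m raises the power of 2 by two, turns (j-1)! into j!, and
    adds one power of ln m.\<close>
  also have "\<dots> = 2 ^ (2 * Suc j - 1) * real n * fact (Suc j - 1) * ln (real m) ^ Suc j"
  proof -
    obtain i where "j = Suc i" using Suc.hyps by (cases j) auto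
    thus ?thesis by (simp add: B_def)
  qed
  finally show ?case by (simp only: m_def)
qed

theorem lemma2p1:
  fixes n k :: nat
  assumes "n \<ge> 9" and "k \<ge> 1"
  shows "real (iter_prime k n)
           < 2 ^ (2 * k - 1) * real n * fact (k - 1) * (ln (real (max k n))) ^ k
       \<and> (k \<ge> n \<longrightarrow> real (iter_prime k n) < (4 * real k * ln (real k)) ^ k)"
proof (intro conjI impI)
  show less: "real (iter_prime k n)
      < 2 ^ (2 * k - 1) * real n * fact (k - 1) * ln (real (max k n)) ^ k"
    by (rule iter_prime_less[OF assms])
  assume "k \<ge> n"
  obtain i where k: "k = Suc i" using assms(2) by (cases k) auto
  have "fact i \<le> real k ^ i"
    by (rule fact_le_power_of_le) (simp add: k)
  \<comment> \<open>For k \<ge> n the factor n (k-1)! is at most k^k, and 2^(2k-1) \<le> 4^k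
    supplies the rest.\<close>
  hence "real n * fact i \<le> real k * real k ^ i" using \<open>k \<ge> n\<close> by (intro mult_mono) auto
  hence nk: "real n * fact (k - 1) \<le> real k ^ k" by (simp add: k)
  have "2 ^ (2 * k - 1) * real n * fact (k - 1) * ln (real (max k n)) ^ k
      = (2 ^ (2 * k - 1) * ln (real k) ^ k) * (real n * fact (k - 1))"
    using \<open>k \<ge> n\<close> by (simp add: max_absorb1 mult_ac)
  also have "\<dots> \<le> (2 ^ (2 * k) * ln (real k) ^ k) * real k ^ k"
  proof -
    have "(2::real) ^ (2 * k - 1) \<le> 2 ^ (2 * k)" by (intro power_increasing) auto
    thus ?thesis using nk assms \<open>k \<ge> n\<close> by (intro mult_mono) auto
  qed
  also have "\<dots> = (4 * real k * ln (real k)) ^ k"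
    unfolding power_mult[of 2 2 k] by (simp add: power_mult_distrib)
  finally show "real (iter_prime k n) < (4 * real k * ln (real k)) ^ k" using less by linarith
qed

end
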